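(* Let $\Sigma$ and $\hat\Sigma$ be symmetric positive definite $p\times p$ matrices and put $\Delta=\Sigma^{-1/2}\hat\Sigma\Sigma^{-1/2}$. Then $$\sup_{\mu\in\mathbb R^p\setminus\{0\}}\frac{\mathrm{SR}(\Sigma;\mu,\Sigma)}{\mathrm{SR}(\hat\Sigma;\mu,\Sigma)}=\frac12\sqrt{\kappa(\Delta)+\frac1{\kappa(\Delta)}+2}.$$ In particular, if $\hat\Sigma=\hat\Sigma(\eta)$ and $\Delta(\eta)=\Sigma^{-1/2}\hat\Sigma(\eta)\Sigma^{-1/2}$, then $$\mathrm{RSRG}(\hat\Sigma(\eta))=\frac12\sqrt{\kappa(\Delta(\eta))+\frac1{\kappa(\Delta(\eta))}+2}.$$
   Context: For $\mu\neq0$ and positive definite $\hat\Sigma,\Sigma$, the Sharpe ratio of the portfolio solving "minimize $h'\hat\Sigma h$ subject to $h'\mu=1$" (i.e. $h\propto\hat\Sigma^{-1}\mu$), when risk is evaluated under the true covariance $\Sigma$, is $$\mathrm{SR}(\hat\Sigma;\mu,\Sigma)=\frac{\mu'\hat\Sigma^{-1}\mu}{\sqrt{\mu'\hat\Sigma^{-1}\Sigma\hat\Sigma^{-1}\mu}},\qquad \mathrm{SR}(\Sigma;\mu,\Sigma)=\sqrt{\mu'\Sigma^{-1}\mu}.$$ $\mathrm{RSRG}(\hat\Sigma)=\mathrm{RSRG}(\hat\Sigma,\Sigma)$ is the smallest $\rho>0$ such that $\mathrm{SR}(\Sigma;\mu,\Sigma)/\rho\le\mathrm{SR}(\hat\Sigma;\mu,\Sigma)$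 for all $\mu\ne0$. $\kappa(\cdot)$ is the condition number (largest eigenvalue divided by smallest). $\hat\Sigma(\eta)=V\mathrm{diag}(\eta)V'$ denotes a positive definite matrix with orthogonal eigenvector matrix $V$ and eigenvalue vector $\eta\in(0,\infty)^p$. *)

theory Defs
  imports "HOL-Analysis.Analysis"
begin

definition pos_def :: "real^'n^'n \<Rightarrow> bool" where
  "pos_def A \<longleftrightarrow> transpose A = A \<and> (\<forall>x. x \<noteq> 0 \<longrightarrow> x \<bullet> (A *v x) > 0)"

definition diag_mat :: "real^'n \<Rightarrow> real^'n^'n" where
  "diag_mat d = (\<chi> i j. if i = j then d $ i else 0)"

(* The principal square root: meaningful only for positive definite A,
   where exactly one such B exists. *)
definition mat_sqrt :: "real^'n^'n \<Rightarrow> real^'n^'n" where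
  "mat_sqrt A = (THE B. pos_def B \<and> B ** B = A)"

definition inv_sqrt :: "real^'n^'n \<Rightarrow> real^'n^'n" where
  "inv_sqrt A = matrix_inv (mat_sqrt A)"

definition eigenvals :: "real^'n^'n \<Rightarrow> real set" where
  "eigenvals A = {l. \<exists>v. v \<noteq> 0 \<and> A *v v = l *\<^sub>R v}"

(* Only used for symmetric matrices, whose real spectrum is finite and nonempty. *)
definition cond_num :: "real^'n^'n \<Rightarrow> real" where
  "cond_num A = Max (eigenvals A) / Min (eigenvals A)"

(* SR S_hat mu S: Sharpe ratio of the portfolio h = S_hat^(-1) mu under mean mu
   and true covariance S, i.e. (h . mu) / sqrt (h . S h). *)
definition SR :: "real^'n^'n \<Rightarrow> real^'n \<Rightarrow> real^'n^'n \<Rightarrow> real" where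
  "SR Sh \<mu> S =
     (\<mu> \<bullet> (matrix_inv Sh *v \<mu>)) /
     sqrt (\<mu> \<bullet> ((matrix_inv Sh ** S ** matrix_inv Sh) *v \<mu>))"

definition RSRG :: "real^'n^'n \<Rightarrow> real^'n^'n \<Rightarrow> real" where
  "RSRG Sh S = (LEAST \<rho>. \<rho> > 0 \<and> (\<forall>\<mu>. \<mu> \<noteq> 0 \<longrightarrow> SR S \<mu> S / \<rho> \<le> SR Sh \<mu> S))"

definition Sigma_hat :: "real^'n^'n \<Rightarrow> real^'n \<Rightarrow> real^'n^'n" where
  "Sigma_hat V \<eta> = V ** diag_mat \<eta> ** transpose V"

definition Delta :: "real^'n^'n \<Rightarrow> real^'n^'n \<Rightarrow> real^'n^'n" where
  "Delta Sh S = inv_sqrt S ** Sh ** inv_sqrt S"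

lemma pos_def_invertible:
  fixes A :: "real^'n^'n"
  assumes "pos_def A"
  shows "invertible A"
proof -
  have "\<forall>x. A *v x = 0 \<longrightarrow> x = 0"
  proof (intro allI impI, rule ccontr)
    fix x assume "A *v x = 0" "x \<noteq> 0"
    moreover from \<open>x \<noteq> 0\<close> assms have "x \<bullet> (A *v x) > 0"
      by (simp add: pos_def_def)
    ultimately show False by simp
  qed
  then show ?thesis
    by (simp add: invertible_left_inverse matrix_left_invertible_ker)
qed

lemma SR_self:
  fixes S :: "real^'n^'n"
  assumes "pos_def S"
  shows "SR S \<mu> S = sqrt (\<mu> \<bullet> (matrix_inv S *v \<mu>))"
proof -
  define y where "y = matrix_inv S *v \<mu>"
  have "S ** matrix_inv S = mat 1 \<and> matrix_inv S ** S = mat 1"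
    using pos_def_invertible[OF assms] unfolding invertible_def matrix_inv_def
    by (rule someI_ex)
  then have inv: "S ** matrix_inv S = mat 1" "matrix_inv S ** S = mat 1"
    by auto
  have "\<mu> = S *v y"
    by (simp add: y_def matrix_vector_mul_assoc inv)
  then have "\<mu> \<bullet> y = y \<bullet> (S *v y)"
    by (simp add: inner_commute)
  moreover have "y \<bullet> (S *v y) \<ge> 0"
    using assms by (cases "y = 0") (auto simp: pos_def_def less_imp_le)
  ultimately show ?thesis
    by (simp add: SR_def inv real_div_sqrt flip: y_def)
qed

end

theory Submission
  imports Defs
begin

text \<open>Let $R$ be the square root of $S$ and $D = R^{-1} S_h R^{-1}$. The substitution
  $\mu = R D y$, a bijection on nonzero vectors, turns the ratio of the two Sharpe ratios into
  $|Dy||y| / (y' D y)$. If $m$ and $M$ are the extreme eigenvalues of $D$, then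
  $(M - D)(D - m) \ge 0$ gives $|Dy|^2 + mM|y|^2 \le (M + m) y'Dy$, so by AM-GM the ratio is at most
  $(M + m) / (2 \sqrt{mM})$. For unit eigenvectors $u$, $v$ belonging to $m < M$, the vector
  $y = \sqrt{M} u + \sqrt{m} v$ attains this bound.\<close>

section \<open>Spectral theorem\<close>

text \<open>A nonzero linear term dominates the quadratic one near t = 0 and makes the value
  negative for one sign of t. This serves as the first-order condition at a maximiser.\<close>

lemma nonneg_quadratic_linear_coeff_zero:
  fixes a c :: real
  assumes "\<And>t. 0 \<le> 2 * t * a + t\<^sup>2 * c"
  shows "a = 0"
proof (rule ccontr)
  assume "a \<noteq> 0"
  have c: "0 \<le> c" using assms[of 1] assms[of "-1"] by simp
  \<comment> \<open>At this \<open>t\<close> the value is -t^2 (c + 2). The denominator c + 1 rather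
    than c covers c = 0 as well.\<close>
  define t where "t = - a / (c + 1)"
  have a: "a = - t * (c + 1)" using c by (simp add: t_def)
  have "2 * t * a + t\<^sup>2 * c = - (t\<^sup>2 * (c + 2))"
    unfolding a by (simp add: algebra_simps power2_eq_square)
  moreover have "0 < t\<^sup>2 * (c + 2)"
    using c \<open>a \<noteq> 0\<close> by (intro mult_pos_pos) (auto simp: t_def)
  ultimately show False using assms[of t] by simp
qed

text \<open>Take a maximiser u of x . f x on the compact unit sphere of \<open>S\<close>, with
  maximum l. Then l - f is positive semidefinite on \<open>S\<close> and its form vanishes at u,
  which forces u into its kernel.\<close>

lemma selfadjoint_eigenvector_in_subspace:
  fixes f :: "'a::euclidean_space \<Rightarrow> 'a"
  assumes f: "linear f" and sa: "\<And>x y. x \<bullet> f y = f x \<bullet> y"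
    and S: "subspace S" "S \<noteq> {0}" "f ` S \<subseteq> S"
  obtains u where "u \<in> S" "norm u = 1" "f u = (u \<bullet> f u) *\<^sub>R u"
proof -
  have "compact (S \<inter> sphere 0 1)"
    by (simp add: closed_Int_compact closed_subspace S)
  moreover obtain z where z: "z \<in> S" "z \<noteq> 0" using S subspace_0 by blast
  then have "(1 / norm z) *\<^sub>R z \<in> S \<inter> sphere 0 1"
    by (simp add: S(1) subspace_scale)
  then have "S \<inter> sphere 0 1 \<noteq> {}" by blast
  moreover have "continuous_on (S \<inter> sphere 0 1) (\<lambda>x. x \<bullet> f x)"
    using f by (intro continuous_intros linear_continuous_on) (simp add: linear_linear)
  ultimately have "\<exists>u\<in>S \<inter> sphere 0 1. \<forall>x\<in>S \<inter> sphere 0 1. x \<bullet> f x \<le> u \<bullet> f u"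
    by (rule continuous_attains_sup)
  then obtain u where u: "u \<in> S" "norm u = 1"
    and mx: "\<And>x. x \<in> S \<Longrightarrow> norm x = 1 \<Longrightarrow> x \<bullet> f x \<le> u \<bullet> f u"
    by (metis IntD1 IntD2 IntI mem_sphere_0)
  define l where "l = u \<bullet> f u"
  define g where "g x = l *\<^sub>R x - f x" for x
  have uu: "u \<bullet> u = 1" using u by (simp add: dot_square_norm)
  have g: "linear g" unfolding g_def
    by (intro linear_compose_sub f linear_scaleR)
  have sg: "x \<bullet> g y = g x \<bullet> y" for x y
    by (simp add: g_def inner_diff_right inner_diff_left sa)
  have psd: "0 \<le> x \<bullet> g x" if "x \<in> S" for x
  proof (cases "x = 0")
    case False
    let ?y = "(1 / norm x) *\<^sub>R x"
    have "?y \<bullet> f ?y \<le> l"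
      unfolding l_def using that False by (intro mx) (auto simp: S(1) subspace_scale)
    then have "x \<bullet> f x / (norm x)\<^sup>2 \<le> l"
      by (simp add: linear_scale[OF f] power2_eq_square)
    then show ?thesis using False
      by (simp add: g_def inner_diff_right dot_square_norm divide_le_eq)
  qed simp
  have gS: "g u \<in> S"
    unfolding g_def using S u by (auto intro!: subspace_diff subspace_scale)
  \<comment> \<open>Perturb u in the direction g u, which lies in \<open>S\<close> by invariance.
    Since u . g u = 0, the form of \<open>g\<close> at u + t g u has no constant term, and its
    linear coefficient is 2 |g u|^2.\<close>
  have "g u \<bullet> g u = 0"
  proof (rule nonneg_quadratic_linear_coeff_zero)
    fix t :: real
    have "u + t *\<^sub>R g u \<in> S" using S u gS by (simp add: subspace_add subspace_scale)
    from psd[OF this]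
    have "0 \<le> (u + t *\<^sub>R g u) \<bullet> (g u + t *\<^sub>R g (g u))"
      by (simp add: linear_add[OF g] linear_scale[OF g])
    moreover have "u \<bullet> g u = 0" by (simp add: g_def inner_diff_right uu l_def)
    moreover have "u \<bullet> g (g u) = g u \<bullet> g u"
      by (rule sg)
    ultimately show "0 \<le> 2 * t * (g u \<bullet> g u) + t\<^sup>2 * (g u \<bullet> g (g u))"
      by (simp add: inner_add_left inner_add_right power2_eq_square algebra_simps)
  qed
  then have "f u = l *\<^sub>R u" by (simp add: g_def)
  with u that show thesis by (simp add: l_def)
qed

text \<open>Induction on the dimension: split off a unit eigenvector u and continue in the part of
  \<open>S\<close> orthogonal to u. Self-adjointness makes that part invariant, and the formulation
  for arbitrary invariant subspaces lets the induction hypothesis apply to it.\<close>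

lemma selfadjoint_orthonormal_eigenbasis:
  fixes f :: "'a::euclidean_space \<Rightarrow> 'a"
  assumes f: "linear f" and sa: "\<And>x y. x \<bullet> f y = f x \<bullet> y"
    and "subspace S" "f ` S \<subseteq> S"
  shows "\<exists>B. pairwise orthogonal B \<and> (\<forall>b\<in>B. norm b = 1 \<and> f b = (b \<bullet> f b) *\<^sub>R b) \<and> span B = S"
  using assms(3,4)
proof (induction "dim S" arbitrary: S rule: less_induct)
  case less
  show ?case
  proof (cases "S = {0}")
    case True
    then show ?thesis by (intro exI[of _ "{}"]) simp
  next
    case False
    obtain u where u: "u \<in> S" "norm u = 1" "f u = (u \<bullet> f u) *\<^sub>R u"
      using selfadjoint_eigenvector_in_subspace[OF f sa less.prems(1) False less.prems(2)] .
    have uu: "u \<bullet> u = 1" using u by (simp add: dot_square_norm)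
    define T where "T = S \<inter> {x. u \<bullet> x = 0}"
    have T: "subspace T"
      unfolding T_def by (intro subspace_inter less.prems subspace_hyperplane)
    have "u \<bullet> f x = 0" if "u \<bullet> x = 0" for x
      using that u(3) sa[of u x] by (metis inner_scaleR_left mult_zero_right)
    then have fT: "f ` T \<subseteq> T" using less.prems by (auto simp: T_def)
    have "u \<notin> T" by (simp add: T_def uu)
    with u(1) have "T \<subset> S" unfolding T_def by blast
    then have "dim T < dim S"
      using T less.prems by (intro dim_psubset) (simp add: span_eq_iff[THEN iffD2])
    from less.hyps[OF this T fT] obtain B where B: "pairwise orthogonal B"
      "\<forall>b\<in>B. norm b = 1 \<and> f b = (b \<bullet> f b) *\<^sub>R b" "span B = T" by blast
    have BT: "B \<subseteq> T" using B(3) span_superset by blast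
    have "pairwise orthogonal (insert u B)"
      using BT by (intro pairwise_orthogonal_insert B) (auto simp: T_def orthogonal_def)
    moreover have "span (insert u B) = S"
    proof
      show "span (insert u B) \<subseteq> S"
        using BT u less.prems by (intro span_minimal) (auto simp: T_def)
      show "S \<subseteq> span (insert u B)"
      proof
        fix x assume "x \<in> S"
        then have "x - (u \<bullet> x) *\<^sub>R u \<in> T"
          using u uu less.prems
          by (auto simp: T_def inner_diff_right intro!: subspace_diff subspace_scale)
        then show "x \<in> span (insert u B)" using B(3) by (auto simp: span_insert)
      qed
    qed
    ultimately show ?thesis using B u by (intro exI[of _ "insert u B"]) auto
  qed
qed

section \<open>Coordinates in an orthonormal eigenbasis of a symmetric matrix\<close>

lemma symmetric_matrix_iff_selfadjoint:
  fixes A :: "real^'n^'n"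
  shows "transpose A = A \<longleftrightarrow> (\<forall>x y. x \<bullet> (A *v y) = (A *v x) \<bullet> y)"
proof -
  have "transpose A = A \<longleftrightarrow> (\<forall>x. transpose A *v x = A *v x)"
    by (rule matrix_eq)
  also have "\<dots> \<longleftrightarrow> (\<forall>x y. (transpose A *v x) \<bullet> y = (A *v x) \<bullet> y)"
    by (metis vector_eq_rdot)
  also have "\<dots> \<longleftrightarrow> (\<forall>x y. x \<bullet> (A *v y) = (A *v x) \<bullet> y)"
    by (simp add: dot_lmul_matrix)
  finally show ?thesis .
qed

text \<open>The basis is an unindexed set, so the eigenvalues are a function on its vectors.
  Symmetry is bundled in so that \<open>A\<close> can be moved across inner products.\<close>

definition eigenbasis :: "real^'n^'n \<Rightarrow> (real^'n) set \<Rightarrow> (real^'n \<Rightarrow> real) \<Rightarrow> bool" where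
  "eigenbasis A B l \<longleftrightarrow> transpose A = A \<and> finite B \<and> pairwise orthogonal B \<and> span B = UNIV \<and>
     (\<forall>b\<in>B. norm b = 1 \<and> A *v b = l b *\<^sub>R b)"

lemma symmetric_matrix_eigenbasis:
  fixes A :: "real^'n^'n"
  assumes A: "transpose A = A"
  obtains B l where "eigenbasis A B l"
proof -
  have sa: "x \<bullet> (A *v y) = (A *v x) \<bullet> y" for x y
    using A symmetric_matrix_iff_selfadjoint by blast
  obtain B where B: "pairwise orthogonal B" "span B = UNIV"
      "\<forall>b\<in>B. norm b = 1 \<and> A *v b = (b \<bullet> (A *v b)) *\<^sub>R b"
    using selfadjoint_orthonormal_eigenbasis[of "(*v) A" UNIV, OF _ sa] by auto
  \<comment> \<open>An orthogonal set without 0 is linearly independent, hence finite.\<close>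
  then have "0 \<notin> B" by auto
  with B(1) have "finite B"
    using pairwise_orthogonal_independent independent_imp_finite by blast
  with A B have "eigenbasis A B (\<lambda>b. b \<bullet> (A *v b))" by (auto simp: eigenbasis_def)
  with that show thesis .
qed

context
  fixes A :: "real^'n^'n" and B l
  assumes eb: "eigenbasis A B l"
begin

lemma eigenbasis_finite: "finite B"
  using eb by (simp add: eigenbasis_def)

lemma eigenbasis_expand: "(\<Sum>b\<in>B. (x \<bullet> b) *\<^sub>R b) = x"
  using eb by (intro orthonormal_basis_expand) (auto simp: eigenbasis_def)

lemma eigenbasis_inner: "x \<bullet> y = (\<Sum>b\<in>B. (x \<bullet> b) * (y \<bullet> b))"
  by (subst eigenbasis_expand[of y, symmetric]) (simp add: inner_sum_right mult.commute)

lemma eigenbasis_orthonormal: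
  "b \<in> B \<Longrightarrow> c \<in> B \<Longrightarrow> b \<bullet> c = (if b = c then 1 else 0)"
  using eb by (auto simp: eigenbasis_def pairwise_def orthogonal_def dot_square_norm)

lemma eigenbasis_eqI: "(\<And>b. b \<in> B \<Longrightarrow> x \<bullet> b = y \<bullet> b) \<Longrightarrow> x = y"
  by (metis (no_types, lifting) eigenbasis_expand sum.cong)

text \<open>Self-adjointness moves \<open>A\<close> onto the eigenvector b, so in these coordinates
  \<open>A\<close> is diagonal.\<close>

lemma eigenbasis_mult_inner: "b \<in> B \<Longrightarrow> (A *v x) \<bullet> b = l b * (x \<bullet> b)"
  using eb symmetric_matrix_iff_selfadjoint[of A] by (metis eigenbasis_def inner_scaleR_right)

lemma eigenbasis_nonempty: "B \<noteq> {}"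
proof
  assume "B = {}"
  \<comment> \<open>The index type is nonempty, so a unit vector at an arbitrary index is a nonzero
    element of the space.\<close>
  then have "axis undefined 1 = (0 :: real^'n)" using eigenbasis_expand[of "axis undefined 1"] by simp
  then show False by simp
qed

text \<open>An eigenvector has some nonzero coordinate, and comparing that coordinate on both sides
  of the eigenvalue equation gives k = l b. The spectrum is thus finite and nonempty, so
  \<open>Max\<close> and \<open>Min\<close> in \<open>cond_num\<close> are meaningful.\<close>

lemma eigenvals_eigenbasis: "eigenvals A = l ` B"
proof
  show "l ` B \<subseteq> eigenvals A"
  proof
    fix k assume "k \<in> l ` B"
    then obtain b where "k = l b" "norm b = 1" "A *v b = l b *\<^sub>R b"
      using eb by (auto simp: eigenbasis_def)
    then have "b \<noteq> 0 \<and> A *v b = k *\<^sub>R b" by auto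
    then show "k \<in> eigenvals A" unfolding eigenvals_def by blast
  qed
  show "eigenvals A \<subseteq> l ` B"
  proof
    fix k assume "k \<in> eigenvals A"
    then obtain v where v: "v \<noteq> 0" "A *v v = k *\<^sub>R v" by (auto simp: eigenvals_def)
    then obtain b where b: "b \<in> B" "v \<bullet> b \<noteq> 0" using eigenbasis_eqI[of v 0] by auto
    then have "k = l b" using eigenbasis_mult_inner[of b v] v by simp
    with b show "k \<in> l ` B" by blast
  qed
qed

end

lemma symmetric_matrix_eq_0I:
  fixes A :: "real^'n^'n"
  assumes A: "transpose A = A" and ev: "eigenvals A \<subseteq> {0}"
  shows "A = 0"
proof -
  obtain B l where e: "eigenbasis A B l" using symmetric_matrix_eigenbasis[OF A] .
  have "A *v x = 0 *v x" for x
    using ev eigenvals_eigenbasis[OF e]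
    by (intro eigenbasis_eqI[OF e]) (auto simp: eigenbasis_mult_inner[OF e])
  then show ?thesis by (simp add: matrix_eq)
qed

section \<open>The principal square root\<close>

text \<open>The root keeps the eigenvectors of \<open>A\<close> and takes the square roots of its
  eigenvalues, which are positive; symmetry, positivity and the square are then checked coordinate
  by coordinate.\<close>

lemma pos_def_sqrt_exists:
  fixes A :: "real^'n^'n"
  assumes A: "pos_def A"
  shows "\<exists>C. pos_def C \<and> C ** C = A"
proof -
  obtain B l where e: "eigenbasis A B l"
    using symmetric_matrix_eigenbasis[of A] A by (auto simp: pos_def_def)
  note [simp] = eigenbasis_finite[OF e]
  have l: "0 < l b" if "b \<in> B" for b
  proof -
    have "b \<noteq> 0" "A *v b = l b *\<^sub>R b" "b \<bullet> b = 1"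
      using e that by (auto simp: eigenbasis_def dot_square_norm)
    then show ?thesis using A by (auto simp: pos_def_def)
  qed
  define g where "g x = (\<Sum>b\<in>B. (sqrt (l b) * (x \<bullet> b)) *\<^sub>R b)" for x
  have "linear g"
    by (rule linearI) (simp_all add: g_def inner_add_left algebra_simps sum.distrib scaleR_sum_right)
  then have C: "matrix g *v x = g x" for x
    by (simp add: matrix_works linear_matrix_vector_mul_eq)
  have gb: "g x \<bullet> b = sqrt (l b) * (x \<bullet> b)" if "b \<in> B" for x b
  proof -
    have "g x \<bullet> b = (\<Sum>c\<in>B. if c = b then sqrt (l b) * (x \<bullet> b) else 0)"
      unfolding g_def inner_sum_left
      using that by (intro sum.cong) (auto simp: eigenbasis_orthonormal[OF e])
    with that show ?thesis by simp
  qed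
  have "x \<bullet> g y = g x \<bullet> y" for x y
    unfolding eigenbasis_inner[OF e, of x "g y"] eigenbasis_inner[OF e, of "g x" y]
    by (intro sum.cong) (simp_all add: gb)
  then have "transpose (matrix g) = matrix g"
    by (simp add: symmetric_matrix_iff_selfadjoint C)
  moreover have "0 < x \<bullet> g x" if "x \<noteq> 0" for x
  proof -
    obtain b where b: "b \<in> B" "x \<bullet> b \<noteq> 0"
      using \<open>x \<noteq> 0\<close> eigenbasis_eqI[OF e, of x 0] by auto
    have "x \<bullet> g x = (\<Sum>b\<in>B. sqrt (l b) * (x \<bullet> b)\<^sup>2)"
      unfolding eigenbasis_inner[OF e, of x "g x"]
      by (intro sum.cong) (auto simp: gb power2_eq_square)
    also have "\<dots> > 0"
      using b l by (intro sum_pos2[of _ b]) (auto intro!: mult_nonneg_nonneg simp: less_imp_le)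
    finally show ?thesis .
  qed
  ultimately have "pos_def (matrix g)" by (simp add: pos_def_def C)
  moreover have "g (g x) = A *v x" for x
    using l by (intro eigenbasis_eqI[OF e])
      (auto simp: gb eigenbasis_mult_inner[OF e] less_imp_le simp flip: mult.assoc)
  then have "matrix g ** matrix g = A"
    by (simp add: matrix_eq C flip: matrix_vector_mul_assoc)
  ultimately show ?thesis by blast
qed

text \<open>If $B^2 = C^2$ and $v$ is an eigenvector of $D = B - C$ with eigenvalue $k$, then pairing
  $BD + DC = 0$ with $v$ on both sides gives $k (v'Bv + v'Cv) = 0$.\<close>

lemma pos_def_sqrt_unique:
  fixes B C :: "real^'n^'n"
  assumes B: "pos_def B" and C: "pos_def C" and eq: "B ** B = C ** C"
  shows "B = C"
proof -
  have sB: "x \<bullet> (B *v y) = (B *v x) \<bullet> y" and sC: "x \<bullet> (C *v y) = (C *v x) \<bullet> y" for x y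
    using B C symmetric_matrix_iff_selfadjoint unfolding pos_def_def by blast+
  have "transpose (B - C) = B - C"
    unfolding symmetric_matrix_iff_selfadjoint
    by (simp add: matrix_vector_mult_diff_rdistrib inner_diff_left inner_diff_right sB sC)
  moreover have "eigenvals (B - C) \<subseteq> {0}"
  proof
    fix k assume "k \<in> eigenvals (B - C)"
    then obtain v where v: "v \<noteq> 0" and "(B - C) *v v = k *\<^sub>R v" by (auto simp: eigenvals_def)
    then have Bv: "B *v v = k *\<^sub>R v + C *v v"
      by (simp add: matrix_vector_mult_diff_rdistrib algebra_simps)
    have "B *v (B *v v) = C *v (C *v v)" by (simp add: matrix_vector_mul_assoc eq)
    \<comment> \<open>Pair B^2 v = C^2 v with v and move one factor across. Substituting B v = k v +
      C v then leaves a multiple of k.\<close>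
    then have "(B *v v) \<bullet> (B *v v) = (C *v v) \<bullet> (C *v v)" by (metis sB sC)
    then have "k * (v \<bullet> (B *v v) + v \<bullet> (C *v v)) = 0"
      unfolding Bv by (simp add: algebra_simps inner_add_left inner_add_right inner_commute)
    moreover have "0 < v \<bullet> (B *v v) + v \<bullet> (C *v v)"
      using B C v by (auto simp: pos_def_def intro!: add_pos_pos)
    ultimately show "k \<in> {0}" by simp
  qed
  ultimately have "B - C = 0" by (rule symmetric_matrix_eq_0I)
  then show ?thesis by simp
qed

lemma mat_sqrt:
  assumes "pos_def A"
  shows "pos_def (mat_sqrt A)" "mat_sqrt A ** mat_sqrt A = A"
proof -
  have "\<exists>!C. pos_def C \<and> C ** C = A"
    using pos_def_sqrt_exists[OF assms] pos_def_sqrt_unique by blast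
  then have "pos_def (mat_sqrt A) \<and> mat_sqrt A ** mat_sqrt A = A"
    unfolding mat_sqrt_def by (rule theI')
  then show "pos_def (mat_sqrt A)" "mat_sqrt A ** mat_sqrt A = A" by auto
qed

section \<open>The Kantorovich inequality\<close>

text \<open>The sharp constant is written through the condition number alone, because both sides
  scale alike when \<open>D\<close> is multiplied by a positive number.\<close>

lemma kantorovich:
  fixes D :: "real^'n^'n"
  assumes D: "pos_def D"
  defines "K \<equiv> 1/2 * sqrt (cond_num D + 1 / cond_num D + 2)"
  shows "norm (D *v y) * norm y \<le> K * (y \<bullet> (D *v y))"
    and "\<exists>y. y \<noteq> 0 \<and> norm (D *v y) * norm y = K * (y \<bullet> (D *v y))"
    and "0 < K"
proof -
  obtain B l where e: "eigenbasis D B l"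
    using symmetric_matrix_eigenbasis[of D] D by (auto simp: pos_def_def)
  define m M where "m = Min (l ` B)" and "M = Max (l ` B)"
  have fin: "finite (l ` B)" "l ` B \<noteq> {}"
    using eigenbasis_finite[OF e] eigenbasis_nonempty[OF e] by auto
  have Db: "D *v b = l b *\<^sub>R b" "norm b = 1" if "b \<in> B" for b
    using e that by (auto simp: eigenbasis_def)
  have lpos: "0 < l b" if "b \<in> B" for b
  proof -
    have "b \<noteq> 0" "b \<bullet> b = 1" using Db(2)[OF that] by (auto simp: dot_square_norm)
    then show ?thesis using D Db(1)[OF that] by (auto simp: pos_def_def)
  qed
  obtain u v where u: "u \<in> B" "l u = m" and v: "v \<in> B" "l v = M"
    using Min_in[OF fin] Max_in[OF fin] by (auto simp: m_def M_def)
  have lm: "m \<le> l b" "l b \<le> M" if "b \<in> B" for b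
    using that fin by (auto simp: m_def M_def)
  have pos: "0 < m" "0 < M" using lpos u v by auto
  \<comment> \<open>With condition number M / m, the expression under the root is the square of M +
    m divided by m M.\<close>
  have K: "K = (M + m) / (2 * sqrt (m * M))"
  proof -
    have "M / m + 1 / (M / m) + 2 = (M + m)\<^sup>2 / (m * M)"
      using pos by (simp add: field_simps power2_eq_square)
    then show ?thesis
      using pos by (simp add: K_def cond_num_def eigenvals_eigenbasis[OF e] real_sqrt_divide
          flip: m_def M_def)
  qed
  show "0 < K" using pos by (simp add: K)
  show "norm (D *v y) * norm y \<le> K * (y \<bullet> (D *v y))"
  proof -
    \<comment> \<open>This sum is y' (M - D) (D - m) y in eigenbasis coordinates; every l b lies
      between m and M.\<close>
    have "0 \<le> (\<Sum>b\<in>B. (M - l b) * (l b - m) * (y \<bullet> b)\<^sup>2)"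
      using lm by (intro sum_nonneg) auto
    also have "\<dots> = (M + m) * (y \<bullet> (D *v y)) - (D *v y) \<bullet> (D *v y) - m * M * (y \<bullet> y)"
      unfolding eigenbasis_inner[OF e, of y "D *v y"] eigenbasis_inner[OF e, of "D *v y" "D *v y"]
        eigenbasis_inner[OF e, of y y] sum_distrib_left sum_subtractf[symmetric]
      by (intro sum.cong) (auto simp: eigenbasis_mult_inner[OF e] algebra_simps power2_eq_square)
    finally have "(norm (D *v y))\<^sup>2 + m * M * (norm y)\<^sup>2 \<le> (M + m) * (y \<bullet> (D *v y))"
      by (simp add: dot_square_norm)
    moreover have "2 * norm (D *v y) * (sqrt (m * M) * norm y)
        \<le> (norm (D *v y))\<^sup>2 + (sqrt (m * M) * norm y)\<^sup>2"
      by (rule sum_squares_bound)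
    ultimately have "2 * sqrt (m * M) * (norm (D *v y) * norm y) \<le> (M + m) * (y \<bullet> (D *v y))"
      using pos by (simp add: power_mult_distrib algebra_simps)
    then show ?thesis using pos by (simp add: K field_simps)
  qed
  show "\<exists>y. y \<noteq> 0 \<and> norm (D *v y) * norm y = K * (y \<bullet> (D *v y))"
  \<comment> \<open>If m = M, then u and v may coincide, but K = 1 and a single eigenvector already
    gives equality. Otherwise u and v are distinct basis vectors, hence orthogonal.\<close>
  proof (cases "m = M")
    case True
    then have "K = 1" using pos by (simp add: K)
    then show ?thesis using Db[OF u(1)] u pos
      by (intro exI[of _ u]) (auto simp: dot_square_norm)
  next
    case False
    then have uv: "u \<bullet> v = 0" "v \<bullet> u = 0" "u \<bullet> u = 1" "v \<bullet> v = 1"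
      using eigenbasis_orthonormal[OF e] u v by auto
    \<comment> \<open>Using only extreme eigenvectors makes (M - D) (D - m) y vanish. The weights
      give |D y|^2 = m M |y|^2, the equality case of AM-GM.\<close>
    define y where "y = sqrt M *\<^sub>R u + sqrt m *\<^sub>R v"
    have Dy: "D *v y = (m * sqrt M) *\<^sub>R u + (M * sqrt m) *\<^sub>R v"
      using Db[OF u(1)] Db[OF v(1)] u v
      by (simp add: y_def matrix_vector_right_distrib matrix_vector_mult_scaleR algebra_simps)
    have yy: "y \<bullet> y = M + m" and yDy: "y \<bullet> (D *v y) = 2 * (m * M)"
      and DD: "(D *v y) \<bullet> (D *v y) = m * M * (M + m)"
      using pos unfolding Dy unfolding y_def
      by (simp_all add: inner_add_left inner_add_right uv algebra_simps)
    have "norm (D *v y) * norm y = sqrt (m * M) * (M + m)"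
      using pos by (simp add: norm_eq_sqrt_inner yy DD real_sqrt_mult)
    also have "\<dots> = K * (y \<bullet> (D *v y))"
    proof -
      define s where "s = sqrt (m * M)"
      have "0 < s" "m * M = s * s" using pos by (auto simp: s_def)
      then show ?thesis unfolding K yDy by (simp flip: s_def)
    qed
    finally show ?thesis using yy pos by (intro exI[of _ y]) auto
  qed
qed

section \<open>Sharpe ratios\<close>

lemma matrix_inv_mult:
  fixes A :: "real^'n^'n"
  assumes "pos_def A"
  shows "A ** matrix_inv A = mat 1" "matrix_inv A ** A = mat 1"
proof -
  have "A ** matrix_inv A = mat 1 \<and> matrix_inv A ** A = mat 1"
    using pos_def_invertible[OF assms] unfolding invertible_def matrix_inv_def
    by (rule someI_ex)
  then show "A ** matrix_inv A = mat 1" "matrix_inv A ** A = mat 1" by auto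
qed

lemma matrix_inv_mult_vec:
  fixes A :: "real^'n^'n"
  assumes "pos_def A"
  shows "A *v (matrix_inv A *v x) = x" "matrix_inv A *v (A *v x) = x"
  by (simp_all add: matrix_vector_mul_assoc matrix_inv_mult[OF assms])

lemma selfadjoint_matrix_inv:
  fixes A :: "real^'n^'n"
  assumes "pos_def A"
  shows "x \<bullet> (matrix_inv A *v y) = (matrix_inv A *v x) \<bullet> y"
  using assms symmetric_matrix_iff_selfadjoint[of A]
  by (metis matrix_inv_mult_vec pos_def_def)

text \<open>\<open>Delta\<close> is a congruence of \<open>Sh\<close> by the symmetric invertible
  R^-1: its form at x is the form of \<open>Sh\<close> at R^-1 x, which is nonzero with x.\<close>

lemma pos_def_Delta:
  assumes S: "pos_def S" and Sh: "pos_def Sh"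
  shows "pos_def (Delta Sh S)"
proof -
  note R = mat_sqrt(1)[OF S]
  have sSh: "x \<bullet> (Sh *v y) = (Sh *v x) \<bullet> y" for x y
    using Sh symmetric_matrix_iff_selfadjoint unfolding pos_def_def by blast
  note sR = selfadjoint_matrix_inv[OF R]
  have D: "Delta Sh S *v x = matrix_inv (mat_sqrt S) *v (Sh *v (matrix_inv (mat_sqrt S) *v x))" for x
    by (simp add: Delta_def inv_sqrt_def matrix_vector_mul_assoc matrix_mul_assoc)
  have "transpose (Delta Sh S) = Delta Sh S"
    unfolding symmetric_matrix_iff_selfadjoint D by (simp add: sR sSh)
  moreover have "0 < x \<bullet> (Delta Sh S *v x)" if "x \<noteq> 0" for x
  proof -
    have "matrix_inv (mat_sqrt S) *v x \<noteq> 0"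
      using that matrix_inv_mult_vec(1)[OF R, of x] by auto
    then show ?thesis using Sh by (simp add: D sR pos_def_def)
  qed
  ultimately show ?thesis by (simp add: pos_def_def)
qed

text \<open>Parametrising the mean as \<open>Sh *v h\<close> makes h the portfolio itself and
  removes the inverses from the ratio.\<close>

lemma SR_mult:
  fixes Sh S :: "real^'n^'n"
  assumes Sh: "pos_def Sh"
  shows "SR Sh (Sh *v h) S = (h \<bullet> (Sh *v h)) / sqrt (h \<bullet> (S *v h))"
proof -
  have "(Sh *v h) \<bullet> (matrix_inv Sh *v (S *v h)) = h \<bullet> (S *v h)"
    by (simp add: selfadjoint_matrix_inv[OF Sh] matrix_inv_mult_vec[OF Sh])
  then show ?thesis
    by (simp add: SR_def matrix_inv_mult_vec[OF Sh] inner_commute[of "Sh *v h" h]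
        flip: matrix_vector_mul_assoc)
qed

lemma SR_whitened:
  fixes Sh S :: "real^'n^'n"
  assumes S: "pos_def S" and Sh: "pos_def Sh"
  defines "R \<equiv> mat_sqrt S" and "D \<equiv> Delta Sh S"
  shows "SR Sh (R *v (D *v y)) S = (y \<bullet> (D *v y)) / norm y"
    and "SR S (R *v (D *v y)) S = norm (D *v y)"
proof -
  note R = mat_sqrt[OF S, folded R_def]
  have sR: "x \<bullet> (R *v z) = (R *v x) \<bullet> z" for x z
    using R symmetric_matrix_iff_selfadjoint unfolding pos_def_def by blast
  have Sq: "h \<bullet> (S *v h) = (norm (R *v h))\<^sup>2" for h
    by (simp add: sR dot_square_norm flip: R(2) matrix_vector_mul_assoc)
  \<comment> \<open>This is the portfolio chosen under \<open>Sh\<close>, since R D y = Sh R^-1 y;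
    its true risk is |R h| = |y|.\<close>
  define h where "h = matrix_inv R *v y"
  have y: "y = R *v h" by (simp add: h_def matrix_inv_mult_vec[OF R(1)])
  have Dy: "R *v (D *v y) = Sh *v h"
    by (simp add: D_def Delta_def inv_sqrt_def h_def matrix_inv_mult_vec[OF R(1)]
        flip: R_def matrix_vector_mul_assoc)
  have "y \<bullet> (D *v y) = h \<bullet> (Sh *v h)"
    unfolding Dy[symmetric] using sR y by metis
  then show "SR Sh (R *v (D *v y)) S = (y \<bullet> (D *v y)) / norm y"
    by (simp add: Dy SR_mult[OF Sh] Sq flip: y)
  \<comment> \<open>This is the portfolio chosen under \<open>S\<close> for the same mean, since S =
    R R; its risk is |R g| = |D y|.\<close>
  define g where "g = matrix_inv R *v (D *v y)"
  have Rg: "R *v g = D *v y" by (simp add: g_def matrix_inv_mult_vec[OF R(1)])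
  then have "R *v (D *v y) = S *v g" by (simp flip: R(2) matrix_vector_mul_assoc)
  then show "SR S (R *v (D *v y)) S = norm (D *v y)"
    by (simp add: SR_mult[OF S] Sq Rg power2_eq_square)
qed

text \<open>Whitening turns the quotient into |D y| |y| / (y' D y), so the Kantorovich bound and its
  equality case carry over along the bijection between y and the mean.\<close>

lemma SR_ratio:
  fixes Sh S :: "real^'n^'n"
  assumes S: "pos_def S" and Sh: "pos_def Sh"
  defines "K \<equiv> 1/2 * sqrt (cond_num (Delta Sh S) + 1 / cond_num (Delta Sh S) + 2)"
  shows "\<mu> \<noteq> 0 \<Longrightarrow> 0 < SR Sh \<mu> S"
    and "\<mu> \<noteq> 0 \<Longrightarrow> SR S \<mu> S / SR Sh \<mu> S \<le> K"
    and "\<exists>\<mu>. \<mu> \<noteq> 0 \<and> SR S \<mu> S / SR Sh \<mu> S = K"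
    and "0 < K"
proof -
  define R D where "R = mat_sqrt S" and "D = Delta Sh S"
  have D: "pos_def D" using pos_def_Delta[OF S Sh] by (simp add: D_def)
  have R: "pos_def R" using mat_sqrt[OF S] by (simp add: R_def)
  note SR = SR_whitened[OF S Sh, folded R_def D_def]
  note kant = kantorovich[OF D, folded K_def[folded D_def]]
  have ypos: "0 < y \<bullet> (D *v y)" if "y \<noteq> 0" for y
    using D that by (simp add: pos_def_def)
  \<comment> \<open>The witness is D^-1 R^-1 \<mu>; if it were 0, then \<mu> = R D y would be 0
    too.\<close>
  have param: "\<exists>y. y \<noteq> 0 \<and> \<mu> = R *v (D *v y)" if "\<mu> \<noteq> 0" for \<mu>
    using that by (intro exI[of _ "matrix_inv D *v (matrix_inv R *v \<mu>)"])
      (metis D R matrix_inv_mult_vec(1) matrix_vector_mult_0_right)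
  show "0 < SR Sh \<mu> S" if "\<mu> \<noteq> 0"
    using param[OF that] by (auto simp: SR ypos)
  show "SR S \<mu> S / SR Sh \<mu> S \<le> K" if nz: "\<mu> \<noteq> 0"
  proof -
    obtain y where y: "y \<noteq> 0" "\<mu> = R *v (D *v y)" using param[OF nz] by blast
    show ?thesis
      unfolding y(2) SR using kant(1)[of y] ypos[OF y(1)] y(1) by (simp add: divide_le_eq)
  qed
  obtain y where y: "y \<noteq> 0" "norm (D *v y) * norm y = K * (y \<bullet> (D *v y))"
    using kant(2) by blast
  have "R *v (D *v y) \<noteq> 0"
    using y(1) by (metis D R matrix_inv_mult_vec(2) matrix_vector_mult_0_right)
  moreover have "SR S (R *v (D *v y)) S / SR Sh (R *v (D *v y)) S = K"
    using y ypos[OF y(1)] by (simp add: SR)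
  ultimately show "\<exists>\<mu>. \<mu> \<noteq> 0 \<and> SR S \<mu> S / SR Sh \<mu> S = K" by blast
  show "0 < K" by (rule kant(3))
qed

text \<open>As the denominators are positive, the admissible \<rho> are exactly the positive upper
  bounds of the quotient. An attained upper bound is the least of them, so \<open>LEAST\<close> is a
  genuine minimum here.\<close>

lemma RSRG_eqI:
  fixes Sh S :: "real^'n^'n"
  assumes pos: "\<And>\<mu>. \<mu> \<noteq> 0 \<Longrightarrow> 0 < SR Sh \<mu> S" and "0 < K"
    and le: "\<And>\<mu>. \<mu> \<noteq> 0 \<Longrightarrow> SR S \<mu> S / SR Sh \<mu> S \<le> K"
    and eq: "\<exists>\<mu>. \<mu> \<noteq> 0 \<and> SR S \<mu> S / SR Sh \<mu> S = K"
  shows "RSRG Sh S = K"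
proof -
  have iff: "SR S \<mu> S / \<rho> \<le> SR Sh \<mu> S \<longleftrightarrow> SR S \<mu> S / SR Sh \<mu> S \<le> \<rho>"
    if "0 < \<rho>" "\<mu> \<noteq> 0" for \<rho> \<mu>
    using that pos[OF that(2)] by (simp add: divide_le_eq mult.commute)
  show ?thesis unfolding RSRG_def
  proof (rule Least_equality)
    show "0 < K \<and> (\<forall>\<mu>. \<mu> \<noteq> 0 \<longrightarrow> SR S \<mu> S / K \<le> SR Sh \<mu> S)"
      using \<open>0 < K\<close> le iff by blast
    show "K \<le> \<rho>" if "0 < \<rho> \<and> (\<forall>\<mu>. \<mu> \<noteq> 0 \<longrightarrow> SR S \<mu> S / \<rho> \<le> SR Sh \<mu> S)" for \<rho>
      using that eq iff by blast
  qed
qed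

text \<open>In the rotated coordinates w = V' x the quadratic form is the sum of the squares of w
  weighted by \<eta>, and w is nonzero with x because V V' = 1.\<close>

lemma pos_def_Sigma_hat:
  assumes V: "orthogonal_matrix V" and eta: "\<And>i. \<eta> $ i > 0"
  shows "pos_def (Sigma_hat V \<eta>)"
proof -
  have diag: "x \<bullet> (diag_mat \<eta> *v z) = (\<Sum>i\<in>UNIV. \<eta> $ i * (x $ i * z $ i))" for x z :: "real^'a"
    by (simp add: inner_vec_def diag_mat_def matrix_vector_mult_def if_distrib if_distribR
        mult.assoc mult.left_commute cong: if_cong)
  have S: "x \<bullet> (Sigma_hat V \<eta> *v z) =
      (transpose V *v x) \<bullet> (diag_mat \<eta> *v (transpose V *v z))" for x z
    by (simp add: Sigma_hat_def dot_lmul_matrix flip: matrix_vector_mul_assoc)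
  have "transpose (Sigma_hat V \<eta>) = Sigma_hat V \<eta>"
    unfolding symmetric_matrix_iff_selfadjoint
    by (metis (no_types, lifting) S diag inner_commute mult.commute sum.cong)
  moreover have "0 < x \<bullet> (Sigma_hat V \<eta> *v x)" if "x \<noteq> 0" for x
  proof -
    define w where "w = transpose V *v x"
    have "V *v w = x"
      using V by (simp add: w_def orthogonal_matrix_def matrix_vector_mul_assoc del: transpose_matrix_vector)
    with that have "w \<noteq> 0" by auto
    then obtain i where "w $ i \<noteq> 0" by (auto simp: vec_eq_iff)
    then have "0 < (\<Sum>i\<in>UNIV. \<eta> $ i * (w $ i * w $ i))"
      using eta by (intro sum_pos2[of _ i]) (auto simp: less_imp_le zero_less_mult_iff linorder_neq_iff)
    then show ?thesis by (simp add: S diag flip: w_def del: transpose_matrix_vector)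
  qed
  ultimately show ?thesis by (simp add: pos_def_def)
qed

theorem lemma1p5p1:
  fixes \<Sigma> :: "real^'n^'n"
  assumes "pos_def \<Sigma>"
  shows "(\<forall>\<Sigma>h :: real^'n^'n. pos_def \<Sigma>h \<longrightarrow>
            (SUP \<mu>\<in>UNIV - {0}. ereal (SR \<Sigma> \<mu> \<Sigma> / SR \<Sigma>h \<mu> \<Sigma>)) =
            ereal (1/2 * sqrt (cond_num (Delta \<Sigma>h \<Sigma>) + 1 / cond_num (Delta \<Sigma>h \<Sigma>) + 2)))
       \<and> (\<forall>(V :: real^'n^'n) (\<eta> :: real^'n). orthogonal_matrix V \<and> (\<forall>i. \<eta> $ i > 0) \<longrightarrow>
            RSRG (Sigma_hat V \<eta>) \<Sigma> =
            1/2 * sqrt (cond_num (Delta (Sigma_hat V \<eta>) \<Sigma>) + 1 / cond_num (Delta (Sigma_hat V \<eta>) \<Sigma>) + 2))"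
proof (intro conjI allI impI)
  fix \<Sigma>h :: "real^'n^'n"
  assume "pos_def \<Sigma>h"
  note SR_ratio = SR_ratio[OF assms this]
  show "(SUP \<mu>\<in>UNIV - {0}. ereal (SR \<Sigma> \<mu> \<Sigma> / SR \<Sigma>h \<mu> \<Sigma>)) =
      ereal (1/2 * sqrt (cond_num (Delta \<Sigma>h \<Sigma>) + 1 / cond_num (Delta \<Sigma>h \<Sigma>) + 2))"
    (is "_ = ereal ?K")
  \<comment> \<open>In the complete lattice \<open>ereal\<close>, a bound for every \<mu> together
    with attainment at one \<mu> determines the supremum.\<close>
  proof (rule antisym)
    show "(SUP \<mu>\<in>UNIV - {0}. ereal (SR \<Sigma> \<mu> \<Sigma> / SR \<Sigma>h \<mu> \<Sigma>)) \<le> ereal ?K"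
      by (rule SUP_least) (use SR_ratio(2) in auto)
    obtain \<mu> where "\<mu> \<noteq> 0" "SR \<Sigma> \<mu> \<Sigma> / SR \<Sigma>h \<mu> \<Sigma> = ?K" using SR_ratio(3) by blast
    then show "ereal ?K \<le> (SUP \<mu>\<in>UNIV - {0}. ereal (SR \<Sigma> \<mu> \<Sigma> / SR \<Sigma>h \<mu> \<Sigma>))"
      by (intro SUP_upper2[of \<mu>]) auto
  qed
next
  fix V :: "real^'n^'n" and \<eta> :: "real^'n"
  assume "orthogonal_matrix V \<and> (\<forall>i. \<eta> $ i > 0)"
  then have "pos_def (Sigma_hat V \<eta>)" by (simp add: pos_def_Sigma_hat)
  note SR_ratio = SR_ratio[OF assms this]
  show "RSRG (Sigma_hat V \<eta>) \<Sigma> =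
      1/2 * sqrt (cond_num (Delta (Sigma_hat V \<eta>) \<Sigma>) + 1 / cond_num (Delta (Sigma_hat V \<eta>) \<Sigma>) + 2)"
    by (rule RSRG_eqI[OF SR_ratio(1) SR_ratio(4) SR_ratio(2) SR_ratio(3)])
qed

end
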